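(* For $15$ symbols, $6$ rows and $10$ columns: there is no proper transposed sesqui array, i.e. there is no $6\times 10$ row-column design on $15$ symbols (with replication number $4$) that satisfies (CC) and (RC) but not (RR). There do, however, exist proper AO-arrays with these parameters (row-column designs satisfying (RC) but neither (RR) nor (CC)), and there also exist triple arrays with these parameters (row-column designs satisfying (RR), (CC) and (RC)).
   Context: A row-column design is an $r\times c$ array on $v$ symbols such that no symbol occurs more than once in any row or any column, and every symbol occurs exactly $e$ times in the array (so $ev=rc$). Identify rows and columns with their symbol sets. (RR): there is a constant $\lambda_{rr}$ such that any two distinct rows have exactly $\lambda_{rr}$ common symbols. (CC): there is a constant $\lambda_{cc}$ such that any two distinct columns have exactly $\lambda_{cc}$ common symbols. (RC): there is a constant $\lambda_{rc}$ such that any row and any column have exactly $\lambda_{rc}$ common symbols. *)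

theory Defs
  imports Main
begin

text \<open>
  An \<open>r \<times> c\<close> array on the symbol set \<open>V\<close> is a function \<open>A\<close> with entry \<open>A i j\<close> in row \<open>i < r\<close> and
  column \<open>j < c\<close>; its values outside this range are irrelevant. The number of symbols \<open>v\<close> is
  \<open>card V\<close>, and \<open>e\<close> is the replication number. Distinct rows (columns) are those with distinct
  indices.
\<close>

definition row_column_design ::
    "nat \<Rightarrow> nat \<Rightarrow> 'a set \<Rightarrow> nat \<Rightarrow> (nat \<Rightarrow> nat \<Rightarrow> 'a) \<Rightarrow> bool" where
  "row_column_design r c V e A \<longleftrightarrow>
     finite V \<and>
     (\<forall>i<r. \<forall>j<c. A i j \<in> V) \<and>
     (\<forall>i<r. inj_on (\<lambda>j. A i j) {..<c}) \<and>
     (\<forall>j<c. inj_on (\<lambda>i. A i j) {..<r}) \<and>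
     (\<forall>x\<in>V. card {(i, j). i < r \<and> j < c \<and> A i j = x} = e)"

definition row_symbols :: "nat \<Rightarrow> (nat \<Rightarrow> nat \<Rightarrow> 'a) \<Rightarrow> nat \<Rightarrow> 'a set" where
  "row_symbols c A i = (\<lambda>j. A i j) ` {..<c}"

definition col_symbols :: "nat \<Rightarrow> (nat \<Rightarrow> nat \<Rightarrow> 'a) \<Rightarrow> nat \<Rightarrow> 'a set" where
  "col_symbols r A j = (\<lambda>i. A i j) ` {..<r}"

definition RR :: "nat \<Rightarrow> nat \<Rightarrow> (nat \<Rightarrow> nat \<Rightarrow> 'a) \<Rightarrow> bool" where
  "RR r c A \<longleftrightarrow>
     (\<exists>l. \<forall>i<r. \<forall>i'<r. i \<noteq> i' \<longrightarrow> card (row_symbols c A i \<inter> row_symbols c A i') = l)"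

definition CC :: "nat \<Rightarrow> nat \<Rightarrow> (nat \<Rightarrow> nat \<Rightarrow> 'a) \<Rightarrow> bool" where
  "CC r c A \<longleftrightarrow>
     (\<exists>l. \<forall>j<c. \<forall>j'<c. j \<noteq> j' \<longrightarrow> card (col_symbols r A j \<inter> col_symbols r A j') = l)"

definition RC :: "nat \<Rightarrow> nat \<Rightarrow> (nat \<Rightarrow> nat \<Rightarrow> 'a) \<Rightarrow> bool" where
  "RC r c A \<longleftrightarrow>
     (\<exists>l. \<forall>i<r. \<forall>j<c. card (row_symbols c A i \<inter> col_symbols r A j) = l)"

definition proper_transposed_sesqui_array ::
    "nat \<Rightarrow> nat \<Rightarrow> 'a set \<Rightarrow> nat \<Rightarrow> (nat \<Rightarrow> nat \<Rightarrow> 'a) \<Rightarrow> bool" where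
  "proper_transposed_sesqui_array r c V e A \<longleftrightarrow>
     row_column_design r c V e A \<and> CC r c A \<and> RC r c A \<and> \<not> RR r c A"

definition proper_AO_array ::
    "nat \<Rightarrow> nat \<Rightarrow> 'a set \<Rightarrow> nat \<Rightarrow> (nat \<Rightarrow> nat \<Rightarrow> 'a) \<Rightarrow> bool" where
  "proper_AO_array r c V e A \<longleftrightarrow>
     row_column_design r c V e A \<and> RC r c A \<and> \<not> RR r c A \<and> \<not> CC r c A"

definition triple_array ::
    "nat \<Rightarrow> nat \<Rightarrow> 'a set \<Rightarrow> nat \<Rightarrow> (nat \<Rightarrow> nat \<Rightarrow> 'a) \<Rightarrow> bool" where
  "triple_array r c V e A \<longleftrightarrow>
     row_column_design r c V e A \<and> RR r c A \<and> CC r c A \<and> RC r c A"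

end

theory Submission
  imports Defs
begin

text \<open>
  In a \<open>6 \<times> 10\<close> design with (CC) and (RC), counting gives column intersections 2 and row-column
  intersections 4. So, reading columns as points and symbols as blocks, we have a 2-(10,4,2) design
  in which distinct blocks meet in 1 or 2 points, and the complement of each row is a set of 5
  blocks covering every point exactly twice. Blocks of such a set pairwise meet in exactly one point.

  Two such sets \<open>S\<close>, \<open>S'\<close> cannot be disjoint. Let \<open>C\<close> be the set of the remaining five blocks, and
  call blocks adjacent if they meet in two points; a block outside one of the three sets has two
  neighbours in it. Counting via \<open>N N\<^sup>T = 4 I + 2 J\<close> shows that adjacent blocks \<open>a \<in> S\<close> and
  \<open>b \<in> S'\<close> have the same neighbours in \<open>C\<close>, whereas two blocks of \<open>S'\<close> have only one common
  neighbour outside \<open>S'\<close>; taking both neighbours of \<open>a\<close> in \<open>S'\<close> gives a contradiction.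

  Thus any two rows share at least 6 symbols, and as one row shares 30 symbols in total with the five
  others, they share exactly 6, which is (RR).
\<close>

section \<open>Disjoint two-fold covers in a 2-(10,4,2) design\<close>

text \<open>Here \<open>n\<close> is the point-block incidence matrix N, integer-valued so that
  differences make sense, and \<open>f x y\<close> is an entry of \<open>N^T N\<close>, the size of
  the intersection of two blocks.\<close>

lemma two_covers_intersect:
  fixes n :: "nat \<Rightarrow> 'a \<Rightarrow> int" and V S S' :: "'a set" and v :: nat
  defines "f \<equiv> \<lambda>x y. \<Sum>p<10. n p x * n p y"
  assumes "card V = 15"
    and n01: "\<And>p x. n p x \<in> {0, 1}"
    and block: "\<And>x. x \<in> V \<Longrightarrow> (\<Sum>p<10. n p x) = 4"
    and repl: "\<And>p. p < 10 \<Longrightarrow> (\<Sum>x\<in>V. n p x) = 6"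
    and pair: "\<And>p q. p < 10 \<Longrightarrow> q < 10 \<Longrightarrow> p \<noteq> q \<Longrightarrow> (\<Sum>x\<in>V. n p x * n q x) = 2"
    and S: "S \<subseteq> V" "\<And>p. p < 10 \<Longrightarrow> (\<Sum>x\<in>S. n p x) = 2"
    and S': "S' \<subseteq> V" "\<And>p. p < 10 \<Longrightarrow> (\<Sum>x\<in>S'. n p x) = 2"
  shows "S \<inter> S' \<noteq> {}"
proof
  have V: "finite V" "card V = 15"
    using \<open>card V = 15\<close> card.infinite by fastforce+
  assume disj: "S \<inter> S' = {}"
  define C where "C = V - (S \<union> S')"
  \<comment> \<open>For distinct blocks of \<open>V\<close>, \<open>g\<close> is 1 if they meet in
    one point and 0 if they meet in two. Adjacency in the counts below is \<open>g x y = 1\<close>,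
    so neighbours meet in exactly one point. On the diagonal \<open>g x x = -2\<close>, hence the
    distinctness checks before each use of \<open>g01\<close>.\<close>
  define g where "g = (\<lambda>x y. 2 - f x y)"
  have fin: "finite S" "finite S'" "finite C"
    using V S(1) S'(1) by (auto simp: C_def intro: finite_subset)
  have Veq: "V = S \<union> S' \<union> C" using S(1) S'(1) by (auto simp: C_def)
  have split: "(\<Sum>x\<in>V. h x) = (\<Sum>x\<in>S. h x) + (\<Sum>x\<in>S'. h x) + (\<Sum>x\<in>C. h x)" for h :: "'a \<Rightarrow> int"
  proof -
    have "(S \<union> S') \<inter> C = {}" by (auto simp: C_def)
    then show ?thesis using fin disj by (simp add: Veq sum.union_disjoint)
  qed
  \<comment> \<open>Since 6 - 2 - 2 = 2, \<open>C\<close> is a two-fold cover too, so the facts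
    about covers apply to all three sets.\<close>
  have C: "(\<Sum>x\<in>C. n p x) = 2" if "p < 10" for p
    using split[of "n p"] repl[OF that] S(2)[OF that] S'(2)[OF that] by simp
  have CV: "C \<subseteq> V" by (auto simp: C_def)
  have nn: "n p x * n p x = n p x" for p x using n01[of p x] by auto
  have fxx: "f x x = 4" if "x \<in> V" for x
    using block[OF that] by (simp add: f_def nn)
  have sym: "f x y = f y x" for x y by (simp add: f_def mult.commute)
  have pair': "(\<Sum>x\<in>V. n p x * n q x) = 2 + (if p = q then 4 else 0)" if "p < 10" "q < 10" for p q
    using that pair[of p q] repl[of p] by (auto simp: nn)
  have cover: "(\<Sum>y\<in>T. f x y) = 4 * k" if "x \<in> V" "\<And>p. p < 10 \<Longrightarrow> (\<Sum>y\<in>T. n p y) = k" for x k T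
  proof -
    have "(\<Sum>y\<in>T. f x y) = (\<Sum>p<10. n p x * (\<Sum>y\<in>T. n p y))"
      unfolding f_def sum_distrib_left by (rule sum.swap)
    also have "\<dots> = (\<Sum>p<10. n p x * k)"
      using that(2) by (intro sum.cong) auto
    also have "\<dots> = 4 * k" by (simp add: sum_distrib_right[symmetric] block[OF that(1)])
    finally show ?thesis .
  qed
  \<comment> \<open>Squaring \<open>N^T N\<close> gives \<open>N^T (4 I + 2 J) N\<close>; the J part
    contributes 2 * 4 * 4 = 32.\<close>
  have ff: "(\<Sum>z\<in>V. f x z * f y z) = 4 * f x y + 32" if "x \<in> V" "y \<in> V" for x y
  proof -
    have "(\<Sum>z\<in>V. f x z * f y z) =
        (\<Sum>z\<in>V. \<Sum>p<10. \<Sum>q<10. n p x * n q y * (n p z * n q z))"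
      unfolding f_def sum_product by (simp add: mult_ac)
    also have "\<dots> = (\<Sum>p<10. \<Sum>q<10. n p x * n q y * (\<Sum>z\<in>V. n p z * n q z))"
      unfolding sum_distrib_left
      by (subst sum.swap) (intro sum.cong refl sum.swap)
    also have "\<dots> = (\<Sum>p<10. \<Sum>q<10. 2 * (n p x * n q y) + (if p = q then 4 * (n p x * n q y) else 0))"
      by (intro sum.cong refl) (auto simp: pair')
    also have "\<dots> = 2 * ((\<Sum>p<10. n p x) * (\<Sum>q<10. n q y)) + 4 * f x y"
      by (simp add: sum.distrib sum_product sum_distrib_left[symmetric] f_def)
    finally show ?thesis using block that by simp
  qed
  \<comment> \<open>Over \<open>z \<noteq> x\<close> the values \<open>(f x z - 1) * (f x z - 2) \<ge> 0\<close> sum to 0.\<close>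
  have f12: "f x y \<in> {1, 2}" if "x \<in> V" "y \<in> V" "x \<noteq> y" for x y
  proof -
    have nonneg: "0 \<le> (k - 1) * (k - 2)" for k :: int
      by (cases "k \<le> 1") (auto intro: mult_nonneg_nonneg mult_nonpos_nonpos)
    have "(\<Sum>z\<in>V. (f x z - 1) * (f x z - 2)) = (\<Sum>z\<in>V. f x z * f x z - 3 * f x z + 2)"
      by (intro sum.cong) (auto simp: algebra_simps)
    \<comment> \<open>48 - 72 + 30 = 6, which the term \<open>z = x\<close> alone accounts for, as
      (4 - 1) * (4 - 2) = 6.\<close>
    also have "\<dots> = 6"
      using ff[of x x] cover[of x V 6] repl V that fxx[of x]
      by (simp add: sum.distrib sum_subtractf sum_distrib_left[symmetric])
    finally have "(\<Sum>z\<in>V - {x}. (f x z - 1) * (f x z - 2)) = 0"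
      using V that fxx[of x] by (simp add: sum_diff1)
    then have "(f x y - 1) * (f x y - 2) = 0"
      using V that nonneg by (subst (asm) sum_nonneg_eq_0_iff) auto
    then show ?thesis by auto
  qed
  have card5: "int (card T) = 5" if "T \<subseteq> V" "\<And>p. p < 10 \<Longrightarrow> (\<Sum>y\<in>T. n p y) = 2" for T
  proof -
    have "4 * int (card T) = (\<Sum>y\<in>T. \<Sum>p<10. n p y)"
      using block that(1) by (simp add: subset_iff)
    also have "\<dots> = (\<Sum>p<10. \<Sum>y\<in>T. n p y)" by (rule sum.swap)
    also have "\<dots> = 20" using that(2) by simp
    finally show ?thesis by simp
  qed
  have f1: "f x y = 1" if T: "T \<subseteq> V" "\<And>p. p < 10 \<Longrightarrow> (\<Sum>y\<in>T. n p y) = 2"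
    and xy: "x \<in> T" "y \<in> T" "x \<noteq> y" for T x y
  proof -
    have finT: "finite T" using T(1) V finite_subset by blast
    \<comment> \<open>The sum is 8 - 5 = 3, and \<open>z = x\<close> already contributes 4 - 1 = 3,
      so the other terms, all nonnegative, vanish.\<close>
    have "(\<Sum>z\<in>T. f x z - 1) = 3"
      using cover[of x T 2] T card5[OF T] xy by (simp add: sum_subtractf subset_iff)
    then have "(\<Sum>z\<in>T - {x}. f x z - 1) = 0"
      using fxx[of x] xy T finT by (simp add: sum_diff1 subset_iff)
    moreover have "\<And>z. z \<in> T - {x} \<Longrightarrow> 0 \<le> f x z - 1"
      using f12[of x] xy T by fastforce
    ultimately have "f x y - 1 = 0"
      using finT xy by (subst (asm) sum_nonneg_eq_0_iff) auto
    then show ?thesis by simp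
  qed
  have g01: "g x y \<in> {0, 1}" if "x \<in> V" "y \<in> V" "x \<noteq> y" for x y
    using f12[OF that] by (auto simp: g_def)
  have g_sum: "(\<Sum>z\<in>T. g x z) = 2" if "x \<in> V" "T \<subseteq> V" "\<And>p. p < 10 \<Longrightarrow> (\<Sum>y\<in>T. n p y) = 2" for x T
    using cover[of x T 2] card5[of T] that by (simp add: g_def sum_subtractf)
  \<comment> \<open>Inside a two-fold cover \<open>f\<close> is the matrix J + 3 I.\<close>
  have own: "(\<Sum>z\<in>T. f x z * h z) = (\<Sum>z\<in>T. h z) + 3 * h x"
    if "T \<subseteq> V" "\<And>p. p < 10 \<Longrightarrow> (\<Sum>y\<in>T. n p y) = 2" "x \<in> T" for T x and h :: "'a \<Rightarrow> int"
  proof -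
    have "finite T" using that(1) V finite_subset by blast
    have "(\<Sum>z\<in>T. f x z * h z) = (\<Sum>z\<in>T. h z + (if z = x then 3 * h z else 0))"
      using that fxx[of x] f1[OF that] by (intro sum.cong) (auto simp: subset_iff)
    then show ?thesis using \<open>finite T\<close> that(3) by (simp add: sum.distrib)
  qed
  have gg: "(\<Sum>z\<in>T. g x z * g y z) = (\<Sum>z\<in>T. f x z * f y z) - 12"
    if "x \<in> V" "y \<in> V" "T \<subseteq> V" "\<And>p. p < 10 \<Longrightarrow> (\<Sum>y\<in>T. n p y) = 2" for x y T
  proof -
    have "(\<Sum>z\<in>T. g x z * g y z) = (\<Sum>z\<in>T. 4 - 2 * f x z - 2 * f y z + f x z * f y z)"
      by (intro sum.cong) (auto simp: g_def algebra_simps)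
    also have "\<dots> = (\<Sum>z\<in>T. f x z * f y z) - 12"
      using cover[of x T 2] cover[of y T 2] card5[of T] that
      by (simp add: sum.distrib sum_subtractf sum_distrib_left[symmetric])
    finally show ?thesis .
  qed
  \<comment> \<open>Of the total \<open>4 * f a b + 32\<close>, the sets \<open>S\<close> and
    \<open>S'\<close> each take \<open>8 + 3 * f a b\<close>. This leaves
    \<open>16 - 2 * f a b\<close> for \<open>C\<close>, and passing to \<open>g\<close> subtracts
    12.\<close>
  have mixed: "(\<Sum>z\<in>C. g a z * g b z) = 2 * g a b" if "a \<in> S" "b \<in> S'" for a b
  proof -
    have ab: "a \<in> V" "b \<in> V" using that S(1) S'(1) by auto
    have "(\<Sum>z\<in>S. f a z * f b z) = 8 + 3 * f a b"
      using own[OF S that(1), of "f b"] cover[OF ab(2) S(2)] by (simp add: sym)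
    moreover have "(\<Sum>z\<in>S'. f a z * f b z) = 8 + 3 * f a b"
      using own[OF S' that(2), of "f a"] cover[OF ab(1) S'(2)] by (simp add: sym mult.commute)
    ultimately show ?thesis
      using split[of "\<lambda>z. f a z * f b z"] ff[OF ab] gg[OF ab CV C] by (simp add: g_def)
  qed
  \<comment> \<open>The total is 36 and \<open>S'\<close> takes 8 + 3 = 11; passing to
    \<open>g\<close> on \<open>S\<close> and on \<open>C\<close> subtracts 12 twice, leaving
    1.\<close>
  have same: "(\<Sum>z\<in>S. g b z * g b' z) + (\<Sum>z\<in>C. g b z * g b' z) = 1"
    if "b \<in> S'" "b' \<in> S'" "b \<noteq> b'" for b b'
  proof -
    have bb: "b \<in> V" "b' \<in> V" using that S'(1) by auto
    have f: "f b b' = 1" using f1[OF S' that] .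
    have "(\<Sum>z\<in>S'. f b z * f b' z) = 11"
      using own[OF S' that(1), of "f b'"] cover[OF bb(2) S'(2)] f by (simp add: sym)
    then show ?thesis
      using split[of "\<lambda>z. f b z * f b' z"] ff[OF bb] gg[OF bb CV C] gg[OF bb S] f by simp
  qed
  obtain a where a: "a \<in> S" using card5[OF S] by fastforce
  have aV: "a \<in> V" and aS': "a \<notin> S'" using a S disj by auto
  have g01a: "g a b \<in> {0, 1}" if "b \<in> S'" for b
    using g01[of a b] that aV aS' S'(1) by blast
  obtain b b' where b: "b \<in> S'" "b' \<in> S'" "b \<noteq> b'" "g a b = 1" "g a b' = 1"
  proof -
    have "(\<Sum>b\<in>S'. g a b) = int (card {b \<in> S'. g a b = 1})"
    proof -
      have "(\<Sum>b\<in>S'. g a b) = (\<Sum>b\<in>S'. if g a b = 1 then 1 else 0)"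
        using g01a by (intro sum.cong) auto
      then show ?thesis using fin by (simp add: sum.If_cases Int_def)
    qed
    then have "card {b \<in> S'. g a b = 1} = 2" using g_sum[OF aV S'] by simp
    then obtain b b' where "{b \<in> S'. g a b = 1} = {b, b'}" "b \<noteq> b'"
      by (auto simp: card_2_iff)
    then show thesis using that[of b b'] by blast
  qed
  have "g a z = g a z * g b z" "g a z = g a z * g b' z" if "z \<in> C" for z
  proof -
    have *: "g a z = g a z * g u z" if u: "u \<in> S'" "g a u = 1" for u
    proof -
      have z: "z \<in> V" "z \<noteq> a" "z \<noteq> u" using \<open>z \<in> C\<close> a u by (auto simp: C_def)
      have nn: "0 \<le> g a z' - g a z' * g u z'" if "z' \<in> C" for z'
      proof -
        have "z' \<in> V" "z' \<noteq> a" "z' \<noteq> u" using that a u by (auto simp: C_def)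
        then show ?thesis using g01[of a z'] g01[of u z'] aV u S'(1) by fastforce
      qed
      \<comment> \<open>The blocks \<open>a\<close> and \<open>u\<close> have two common neighbours
        in \<open>C\<close>, and \<open>a\<close> has only two there.\<close>
      have "(\<Sum>z\<in>C. g a z - g a z * g u z) = 0"
        using mixed[OF a u(1)] g_sum[OF aV CV C] u by (simp add: sum_subtractf)
      then have "g a z - g a z * g u z = 0"
        using \<open>z \<in> C\<close> nn fin by (subst (asm) sum_nonneg_eq_0_iff) auto
      then show ?thesis by simp
    qed
    show "g a z = g a z * g b z" "g a z = g a z * g b' z" using * b by blast+
  qed
  note dom = this
  have g01S': "g u z \<in> {0, 1}" if "u \<in> S'" "z \<in> S \<union> C" for u z
    using that g01[of u z] S(1) S'(1) disj by (auto simp: C_def)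
  \<comment> \<open>Both neighbours of \<open>a\<close> in \<open>C\<close> are common neighbours of
    \<open>b\<close> and \<open>b'\<close>, while \<open>same\<close> allows only one.\<close>
  have "g a z \<le> g b z * g b' z" if "z \<in> C" for z
  proof -
    have "g a z \<in> {0, 1}" using g01[of a z] aV CV a that by (auto simp: C_def)
    then show ?thesis using dom[OF that] g01S'[of b z] g01S'[of b' z] that b by auto
  qed
  then have "(\<Sum>z\<in>C. g a z) \<le> (\<Sum>z\<in>C. g b z * g b' z)" by (rule sum_mono)
  moreover have "0 \<le> (\<Sum>z\<in>S. g b z * g b' z)"
  proof (rule sum_nonneg)
    show "0 \<le> g b z * g b' z" if "z \<in> S" for z
      using g01S'[of b z] g01S'[of b' z] that b by auto
  qed
  ultimately show False
    using same[OF b(1-3)] g_sum[OF aV CV C] by simp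
qed

section \<open>Counting in the array: (CC) and (RC) force (RR)\<close>

text \<open>No symbol repeats in a row or column, so both coordinate projections are injective on
  the cells holding \<open>x\<close>.\<close>

lemma row_column_design_symbol_counts:
  assumes "row_column_design r c V e A" "x \<in> V"
  shows "card {j. j < c \<and> x \<in> col_symbols r A j} = e"
    and "card {i. i < r \<and> x \<in> row_symbols c A i} = e"
proof -
  let ?K = "{(i, j). i < r \<and> j < c \<and> A i j = x}"
  have K: "card ?K = e" using assms by (auto simp: row_column_design_def)
  have "inj_on snd ?K"
    using assms unfolding row_column_design_def inj_on_def by fastforce
  moreover have "snd ` ?K = {j. j < c \<and> x \<in> col_symbols r A j}"
    by (force simp: col_symbols_def)
  ultimately show "card {j. j < c \<and> x \<in> col_symbols r A j} = e"
    using K card_image[of snd ?K] by simp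
  have "inj_on fst ?K"
    using assms unfolding row_column_design_def inj_on_def by fastforce
  moreover have "fst ` ?K = {i. i < r \<and> x \<in> row_symbols c A i}"
    by (force simp: row_symbols_def)
  ultimately show "card {i. i < r \<and> x \<in> row_symbols c A i} = e"
    using K card_image[of fst ?K] by simp
qed

text \<open>Double counting of the pairs \<open>(x, i)\<close> with \<open>x\<close> in
  \<open>F i\<close>.\<close>

lemma sum_card_Int_eq:
  assumes "finite X" "finite I" "\<And>x. x \<in> X \<Longrightarrow> card {i \<in> I. x \<in> F i} = e"
  shows "(\<Sum>i\<in>I. card (X \<inter> F i)) = card X * e"
proof -
  have "(\<Sum>i\<in>I. card (X \<inter> F i)) = (\<Sum>i\<in>I. \<Sum>x\<in>X. of_bool (x \<in> F i))"
    using assms(1) by simp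
  also have "\<dots> = (\<Sum>x\<in>X. \<Sum>i\<in>I. of_bool (x \<in> F i))" by (rule sum.swap)
  also have "\<dots> = (\<Sum>x\<in>X. e)"
    using assms(2,3) by (intro sum.cong) (simp_all add: Int_def)
  finally show ?thesis by simp
qed

lemma CC_RC_imp_RR:
  assumes D: "row_column_design 6 10 V 4 A" and V: "card V = 15"
    and "CC 6 10 A" "RC 6 10 A"
  shows "RR 6 10 A"
proof -
  define R where "R = row_symbols 10 A"
  define C where "C = col_symbols 6 A"
  define n :: "nat \<Rightarrow> 'a \<Rightarrow> int" where "n = (\<lambda>j x. of_bool (x \<in> C j))"
  have finV: "finite V" using D by (simp add: row_column_design_def)
  have RV: "R i \<subseteq> V" if "i < 6" for i
    using D that by (auto simp: row_column_design_def R_def row_symbols_def)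
  have CV: "C j \<subseteq> V" if "j < 10" for j
    using D that by (auto simp: row_column_design_def C_def col_symbols_def)
  have cardR: "card (R i) = 10" if "i < 6" for i
    using D that by (simp add: row_column_design_def R_def row_symbols_def card_image)
  have cardC: "card (C j) = 6" if "j < 10" for j
    using D that by (simp add: row_column_design_def C_def col_symbols_def card_image)
  have finR: "finite (R i)" and finC: "finite (C j)" for i j
    by (simp_all add: R_def C_def row_symbols_def col_symbols_def)
  have inR: "card {i \<in> {..<6}. x \<in> R i} = 4" and inC: "card {j \<in> {..<10}. x \<in> C j} = 4"
    if "x \<in> V" for x
    using row_column_design_symbol_counts[OF D that] by (simp_all add: R_def C_def)
  obtain l where l: "\<And>j j'. j < 10 \<Longrightarrow> j' < 10 \<Longrightarrow> j \<noteq> j' \<Longrightarrow> card (C j \<inter> C j') = l"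
    using \<open>CC 6 10 A\<close> by (auto simp: CC_def C_def)
  have "24 = (\<Sum>j<10. card (C 0 \<inter> C j))"
    using sum_card_Int_eq[of "C 0" "{..<10}" C 4] inC CV[of 0] cardC[of 0] finC by (auto simp: subset_iff)
  also have "\<dots> = card (C 0 \<inter> C 0) + (\<Sum>j\<in>{..<10} - {0}. card (C 0 \<inter> C j))"
    by (rule sum.remove) auto
  also have "\<dots> = 6 + 9 * l"
    using l cardC[of 0] by simp
  finally have l2: "l = 2" by simp
  obtain m where m: "\<And>i j. i < 6 \<Longrightarrow> j < 10 \<Longrightarrow> card (R i \<inter> C j) = m"
    using \<open>RC 6 10 A\<close> by (auto simp: RC_def R_def C_def)
  have "40 = (\<Sum>j<10. card (R 0 \<inter> C j))"
    using sum_card_Int_eq[of "R 0" "{..<10}" C 4] inC RV[of 0] cardR[of 0] finR by (auto simp: subset_iff)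
  then have m4: "m = 4" using m by simp
  have n_sum: "(\<Sum>x\<in>T. n j x) = int (card (T \<inter> C j))" if "finite T" for T j
    using that by (simp add: n_def)
  have ge: "6 \<le> card (R i \<inter> R i')" if "i < 6" "i' < 6" for i i'
  proof -
    have cover: "(\<Sum>x\<in>V - R k. n j x) = 2" if "k < 6" "j < 10" for k j
    proof -
      have "(V - R k) \<inter> C j = C j - R k \<inter> C j" using CV[OF that(2)] by auto
      then show ?thesis
        using n_sum[of "V - R k" j] finV m[OF that] m4 cardC[OF that(2)] finC
        by (simp add: card_Diff_subset)
    qed
    have "(V - R i) \<inter> (V - R i') \<noteq> {}"
    proof (rule two_covers_intersect[of V n, OF V])
      show "n p x \<in> {0, 1}" for p x by (simp add: n_def)
      show "(\<Sum>p<10. n p x) = 4" if "x \<in> V" for x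
        using inC[OF that] by (simp add: n_def Int_def)
      show "(\<Sum>x\<in>V. n p x) = 6" if "p < 10" for p
        using n_sum[OF finV] CV[OF that] cardC[OF that] by (simp add: Int_absorb1)
      show "(\<Sum>x\<in>V. n p x * n q x) = 2" if "p < 10" "q < 10" "p \<noteq> q" for p q
      proof -
        have "(\<Sum>x\<in>V. n p x * n q x) = (\<Sum>x\<in>V. of_bool (x \<in> C p \<inter> C q))"
          by (intro sum.cong) (auto simp: n_def)
        also have "\<dots> = int (card (V \<inter> (C p \<inter> C q)))"
          using finV by (simp only: sum_of_bool_eq Collect_mem_eq of_nat_eq_iff)
        also have "V \<inter> (C p \<inter> C q) = C p \<inter> C q" using CV[OF that(1)] by auto
        finally show ?thesis using l[OF that] l2 by simp
      qed
    qed (use cover that in auto)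
    then have "R i \<union> R i' \<subset> V" using RV that by blast
    then have "card (R i \<union> R i') < 15"
      using psubset_card_mono[OF finV] V by metis
    then show ?thesis
      using card_Un_Int[of "R i" "R i'"] cardR that finR by simp
  qed
  have "card (R i \<inter> R i') = 6" if i: "i < 6" "i' < 6" "i \<noteq> i'" for i i'
  proof -
    have "40 = (\<Sum>k<6. card (R i \<inter> R k))"
      using sum_card_Int_eq[of "R i" "{..<6}" R 4] inR RV[OF i(1)] cardR[OF i(1)] finR
      by (auto simp: subset_iff)
    also have "\<dots> = card (R i \<inter> R i) + (\<Sum>k\<in>{..<6} - {i}. card (R i \<inter> R k))"
      using i by (intro sum.remove) auto
    also have "(\<Sum>k\<in>{..<6} - {i}. card (R i \<inter> R k)) =
        card (R i \<inter> R i') + (\<Sum>k\<in>{..<6} - {i} - {i'}. card (R i \<inter> R k))"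
      using i by (intro sum.remove) auto
    finally have "30 = card (R i \<inter> R i') + (\<Sum>k\<in>{..<6} - {i} - {i'}. card (R i \<inter> R k))"
      using cardR[OF i(1)] by simp
    \<comment> \<open>The other four rows use at least 24 of the 30, so at most 6 remain for row
      \<open>i'\<close>; \<open>ge\<close> gives the reverse bound.\<close>
    moreover have "(\<Sum>k\<in>{..<6} - {i} - {i'}. 6) \<le> (\<Sum>k\<in>{..<6} - {i} - {i'}. card (R i \<inter> R k))"
      using ge i by (intro sum_mono) auto
    moreover have "card ({..<6} - {i} - {i'}) = 4" using i by simp
    ultimately show ?thesis using ge[OF i(1,2)] by simp
  qed
  then show ?thesis by (auto simp: RR_def R_def)
qed

section \<open>Evaluation on lists and relabelling of symbols\<close>

text \<open>Bounded quantifiers and cardinalities become list operations, so that a concrete array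
  can be checked by evaluation.\<close>

lemma row_column_design_list:
  "row_column_design r c {..<v} e A \<longleftrightarrow>
     (\<forall>i\<in>set [0..<r]. \<forall>j\<in>set [0..<c]. A i j < v) \<and>
     (\<forall>i\<in>set [0..<r]. distinct (map (A i) [0..<c])) \<and>
     (\<forall>j\<in>set [0..<c]. distinct (map (\<lambda>i. A i j) [0..<r])) \<and>
     (\<forall>x\<in>set [0..<v].
        length (filter (\<lambda>(i, j). A i j = x) (List.product [0..<r] [0..<c])) = e)"
proof -
  have "card {(i, j). i < r \<and> j < c \<and> A i j = x} =
      length (filter (\<lambda>(i, j). A i j = x) (List.product [0..<r] [0..<c]))" for x
  proof -
    have "{(i, j). i < r \<and> j < c \<and> A i j = x} =
        set (filter (\<lambda>(i, j). A i j = x) (List.product [0..<r] [0..<c]))"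
      by auto
    then show ?thesis
      by (simp only: distinct_card distinct_filter distinct_product distinct_upt)
  qed
  then show ?thesis
    unfolding row_column_design_def distinct_map atLeast_upt[symmetric] set_upt
    by (auto simp: lessThan_atLeast0)
qed

lemma card_image_Int_list:
  "card (f ` {..<m} \<inter> g ` {..<n}) =
     length (remdups (filter (\<lambda>x. x \<in> set (map g [0..<n])) (map f [0..<m])))"
proof -
  have "f ` {..<m} \<inter> g ` {..<n} =
      set (filter (\<lambda>x. x \<in> set (map g [0..<n])) (map f [0..<m]))"
    by auto
  then show ?thesis by (simp only: length_remdups_card_conv)
qed

text \<open>Relabelling carries the concrete arrays on \<open>{..<15}\<close> over to an arbitrary
  15-element symbol set.\<close>

lemma row_column_design_comp:
  assumes "row_column_design r c V e A" "inj_on h V"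
  shows "row_column_design r c (h ` V) e (\<lambda>i j. h (A i j))"
proof -
  have "{(i, j). i < r \<and> j < c \<and> h (A i j) = h x} = {(i, j). i < r \<and> j < c \<and> A i j = x}"
    if "x \<in> V" for x
    using assms that by (auto simp: row_column_design_def inj_on_eq_iff)
  then show ?thesis
    using assms unfolding row_column_design_def
    by (auto simp: inj_on_def)
qed

lemma card_Int_image:
  assumes "inj_on h V" "X \<subseteq> V" "Y \<subseteq> V"
  shows "card (h ` X \<inter> h ` Y) = card (X \<inter> Y)"
proof -
  have "h ` X \<inter> h ` Y = h ` (X \<inter> Y)"
    using assms by (simp add: inj_on_image_Int)
  then show ?thesis
    using assms by (simp add: card_image inj_on_subset[OF assms(1)] le_infI1)
qed

lemma row_symbols_comp: "row_symbols c (\<lambda>i j. h (A i j)) i = h ` row_symbols c A i"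
  by (simp add: row_symbols_def image_image)

lemma col_symbols_comp: "col_symbols r (\<lambda>i j. h (A i j)) j = h ` col_symbols r A j"
  by (simp add: col_symbols_def image_image)

lemma RR_comp:
  assumes "inj_on h V" "\<forall>i<r. \<forall>j<c. A i j \<in> V"
  shows "RR r c (\<lambda>i j. h (A i j)) \<longleftrightarrow> RR r c A"
proof -
  have "row_symbols c A i \<subseteq> V" if "i < r" for i
    using assms(2) that by (auto simp: row_symbols_def)
  then show ?thesis
    by (simp add: RR_def row_symbols_comp card_Int_image[OF assms(1)])
qed

lemma CC_comp:
  assumes "inj_on h V" "\<forall>i<r. \<forall>j<c. A i j \<in> V"
  shows "CC r c (\<lambda>i j. h (A i j)) \<longleftrightarrow> CC r c A"
proof -
  have "col_symbols r A j \<subseteq> V" if "j < c" for j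
    using assms(2) that by (auto simp: col_symbols_def)
  then show ?thesis
    by (simp add: CC_def col_symbols_comp card_Int_image[OF assms(1)])
qed

lemma RC_comp:
  assumes "inj_on h V" "\<forall>i<r. \<forall>j<c. A i j \<in> V"
  shows "RC r c (\<lambda>i j. h (A i j)) \<longleftrightarrow> RC r c A"
proof -
  have "row_symbols c A i \<subseteq> V" if "i < r" for i
    using assms(2) that by (auto simp: row_symbols_def)
  moreover have "col_symbols r A j \<subseteq> V" if "j < c" for j
    using assms(2) that by (auto simp: col_symbols_def)
  ultimately show ?thesis
    by (simp add: RC_def row_symbols_comp col_symbols_comp card_Int_image[OF assms(1)])
qed

lemma triple_array_comp:
  assumes "triple_array r c V e A" "inj_on h V"
  shows "triple_array r c (h ` V) e (\<lambda>i j. h (A i j))"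
proof -
  have "\<forall>i<r. \<forall>j<c. A i j \<in> V"
    using assms(1) by (simp add: triple_array_def row_column_design_def)
  with assms show ?thesis
    by (simp add: triple_array_def row_column_design_comp RR_comp CC_comp RC_comp)
qed

lemma proper_AO_array_comp:
  assumes "proper_AO_array r c V e A" "inj_on h V"
  shows "proper_AO_array r c (h ` V) e (\<lambda>i j. h (A i j))"
proof -
  have "\<forall>i<r. \<forall>j<c. A i j \<in> V"
    using assms(1) by (simp add: proper_AO_array_def row_column_design_def)
  with assms show ?thesis
    by (simp add: proper_AO_array_def row_column_design_comp RR_comp CC_comp RC_comp)
qed

section \<open>The explicit arrays\<close>

lemma all_pairs_list:
  "(\<forall>i<m. \<forall>j<n. P i j) \<longleftrightarrow> (\<forall>i\<in>set [0..<m]. \<forall>j\<in>set [0..<n]. P i j)"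
  by auto

text \<open>
  The array \<open>triple_rows\<close> is built on the edges of \<open>K\<^sub>6\<close>: row \<open>i\<close> holds the edges avoiding vertex
  \<open>i\<close>, and the columns are ten two-factors pairwise sharing two edges. For \<open>AO_rows\<close> the edges 01
  and 23 are switched to second copies of 02 and 13, which destroys (RR), while any ten two-factors
  covering each edge four times keep (RC).
\<close>

definition triple_rows :: "nat list list" where
  "triple_rows =
    [[13, 10, 8, 11, 14, 6, 9, 7, 5, 12],
     [1, 11, 14, 12, 3, 13, 4, 9, 10, 2],
     [14, 7, 2, 6, 4, 3, 12, 0, 13, 8],
     [7, 4, 10, 14, 5, 1, 8, 11, 0, 3],
     [5, 2, 9, 0, 6, 8, 1, 13, 4, 11],
     [2, 6, 0, 1, 9, 10, 7, 3, 12, 5]]"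

definition AO_rows :: "nat list list" where
  "AO_rows =
    [[10, 5, 4, 12, 11, 7, 14, 8, 9, 6],
     [13, 3, 0, 2, 1, 10, 8, 12, 11, 9],
     [3, 10, 14, 1, 7, 11, 12, 5, 6, 2],
     [8, 0, 12, 9, 6, 4, 3, 7, 2, 13],
     [7, 9, 3, 14, 0, 13, 5, 1, 4, 11],
     [14, 6, 10, 4, 8, 2, 0, 13, 1, 5]]"

text \<open>Symbols 0 to 14 number the edges 01, 02, ..., 45 in lexicographic order. Two vertices
  touch 9 edges and miss 6, and a two-factor has 6 - 2 = 4 edges avoiding a given vertex; hence the
  witnesses 6 for (RR) and 4 for (RC).\<close>

lemma triple_array_triple_rows:
  "triple_array 6 10 {..<15} 4 (\<lambda>i j. triple_rows ! i ! j)"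
proof -
  have "row_column_design 6 10 {..<15} 4 (\<lambda>i j. triple_rows ! i ! j)"
    unfolding row_column_design_list triple_rows_def by code_simp
  moreover have "RR 6 10 (\<lambda>i j. triple_rows ! i ! j)"
    unfolding RR_def all_pairs_list row_symbols_def card_image_Int_list
    by (rule exI[of _ 6], unfold triple_rows_def, code_simp)
  moreover have "CC 6 10 (\<lambda>i j. triple_rows ! i ! j)"
    unfolding CC_def all_pairs_list col_symbols_def card_image_Int_list
    by (rule exI[of _ 2], unfold triple_rows_def, code_simp)
  moreover have "RC 6 10 (\<lambda>i j. triple_rows ! i ! j)"
    unfolding RC_def all_pairs_list row_symbols_def col_symbols_def card_image_Int_list
    by (rule exI[of _ 4], unfold triple_rows_def, code_simp)
  ultimately show ?thesis by (simp add: triple_array_def)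
qed

lemma proper_AO_array_AO_rows:
  "proper_AO_array 6 10 {..<15} 4 (\<lambda>i j. AO_rows ! i ! j)"
proof -
  let ?A = "\<lambda>i j. AO_rows ! i ! j"
  have "row_column_design 6 10 {..<15} 4 ?A"
    unfolding row_column_design_list AO_rows_def by code_simp
  moreover have "RC 6 10 ?A"
    unfolding RC_def all_pairs_list row_symbols_def col_symbols_def card_image_Int_list
    by (rule exI[of _ 4], unfold AO_rows_def, code_simp)
  moreover have "\<not> RR 6 10 ?A"
  proof -
    \<comment> \<open>After the switch no edge joins 0 and 1 but two edges join 0 and 2, so these
      pairs of rows share 5 and 7 symbols.\<close>
    have "card (row_symbols 10 ?A 0 \<inter> row_symbols 10 ?A 1) \<noteq>
        card (row_symbols 10 ?A 0 \<inter> row_symbols 10 ?A 2)"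
      unfolding row_symbols_def card_image_Int_list AO_rows_def by code_simp
    then show ?thesis unfolding RR_def by fastforce
  qed
  moreover have "\<not> CC 6 10 ?A"
  proof -
    \<comment> \<open>Columns 0 and 1 share exactly 3 and 10; columns 0 and 2 also share 14.\<close>
    have "card (col_symbols 6 ?A 0 \<inter> col_symbols 6 ?A 1) \<noteq>
        card (col_symbols 6 ?A 0 \<inter> col_symbols 6 ?A 2)"
      unfolding col_symbols_def card_image_Int_list AO_rows_def by code_simp
    then show ?thesis unfolding CC_def by fastforce
  qed
  ultimately show ?thesis by (simp add: proper_AO_array_def)
qed

theorem mainTheorem5:
  fixes V :: "'a set"
  assumes "card V = 15"
  shows "\<not> (\<exists>A. proper_transposed_sesqui_array 6 10 V 4 A) \<and>
         (\<exists>A. proper_AO_array 6 10 V 4 A) \<and>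
         (\<exists>A. triple_array 6 10 V 4 A)"
proof (intro conjI)
  show "\<not> (\<exists>A. proper_transposed_sesqui_array 6 10 V 4 A)"
    using CC_RC_imp_RR assms by (auto simp: proper_transposed_sesqui_array_def)
  have "finite V" using assms card.infinite by fastforce
  then obtain h where "bij_betw h {..<15::nat} V"
    using assms ex_bij_betw_nat_finite[of V] by (auto simp: lessThan_atLeast0)
  then have h: "inj_on h {..<15}" "h ` {..<15} = V"
    by (auto simp: bij_betw_def)
  show "\<exists>A. proper_AO_array 6 10 V 4 A"
    using proper_AO_array_comp[OF proper_AO_array_AO_rows h(1)] h(2) by auto
  show "\<exists>A. triple_array 6 10 V 4 A"
    using triple_array_comp[OF triple_array_triple_rows h(1)] h(2) by auto
qed

end
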